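(* Let $\delta$ be a fixed real number with $0<\delta<1/2$. Then there exist constants $c>0$ and $N$, depending only on $\delta$, such that for every integer $n\ge N$ for which $d=\delta n$ is an integer, $$M(n,d)\;\ge\; c\,n\,\frac{n!}{V(n,d-1)}.$$ Equivalently, with $d/n=\delta$ fixed, $M(n,d)=\Omega\!\left(\frac{n!}{V(n,d-1)}\,n\right)$ as $n\to\infty$.
   Context: $\mathcal{S}_n$ denotes the symmetric group of permutations of $[n]=\{1,\dots,n\}$. The Hamming distance between $\sigma,\tau\in\mathcal{S}_n$ is $d(\sigma,\tau)=|\{i\in[n]:\sigma(i)\ne\tau(i)\}|$. A permutation code $C\subseteq\mathcal{S}_n$ has minimum distance $d$ if every pair of distinct permutations in $C$ is at Hamming distance at least $d$; $M(n,d)$ is the maximum size of a permutation code in $\mathcal{S}_n$ of minimum distance $d$. For $k\ge0$, $D_k$ denotes the number of derangements (fixed-point-free permutations) of $k$ elements (with $D_0=1$), and $V(n,r)=\sum_{k=0}^{r}\binom{n}{k}D_k$ is the volume of a Hamming sphere of radius $r$ in $\mathcal{S}_n$. *)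

theory Defs
  imports Complex_Main "HOL-Combinatorics.Permutations"
begin

definition sym_perms :: "nat \<Rightarrow> (nat \<Rightarrow> nat) set" where
  "sym_perms n = {\<sigma>. \<sigma> permutes {1..n}}"

definition hamming_dist :: "nat \<Rightarrow> (nat \<Rightarrow> nat) \<Rightarrow> (nat \<Rightarrow> nat) \<Rightarrow> nat" where
  "hamming_dist n \<sigma> \<tau> = card {i \<in> {1..n}. \<sigma> i \<noteq> \<tau> i}"

definition perm_code :: "nat \<Rightarrow> nat \<Rightarrow> (nat \<Rightarrow> nat) set \<Rightarrow> bool" where
  "perm_code n d C \<longleftrightarrow> C \<subseteq> sym_perms n \<and>
     (\<forall>\<sigma>\<in>C. \<forall>\<tau>\<in>C. \<sigma> \<noteq> \<tau> \<longrightarrow> d \<le> hamming_dist n \<sigma> \<tau>)"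

definition max_code_size :: "nat \<Rightarrow> nat \<Rightarrow> nat" where
  "max_code_size n d = Max {card C | C. perm_code n d C}"

definition num_derangements :: "nat \<Rightarrow> nat" where
  "num_derangements k = card {\<sigma> \<in> sym_perms k. \<forall>i\<in>{1..k}. \<sigma> i \<noteq> i}"

definition sphere_vol :: "nat \<Rightarrow> nat \<Rightarrow> nat" where
  "sphere_vol n r = (\<Sum>k=0..r. (n choose k) * num_derangements k)"

lemma finite_sym_perms: "finite (sym_perms n)"
  unfolding sym_perms_def by (rule finite_permutations) simp

text \<open>The set whose maximum defines \<^const>\<open>max_code_size\<close> is finite and nonempty,
  so \<^const>\<open>Max\<close> is meaningful.\<close>

lemma finite_perm_code_sizes: "finite {card C | C. perm_code n d C}"
proof -
  have "{card C | C. perm_code n d C} \<subseteq> card ` Pow (sym_perms n)"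
    by (auto simp: perm_code_def)
  then show ?thesis
    using finite_sym_perms finite_subset by blast
qed

lemma perm_code_sizes_nonempty: "{card C | C. perm_code n d C} \<noteq> {}"
proof -
  have "perm_code n d {}" by (simp add: perm_code_def)
  then show ?thesis by blast
qed

lemma num_derangements_0: "num_derangements 0 = 1"
  by (simp add: num_derangements_def sym_perms_def)

end

theory Submission
  imports Defs
begin

text \<open>
  Join two permutations by an edge when their distance lies between \<open>1\<close> and \<open>d - 1\<close>; codes are
  the independent sets of this graph, whose degrees are below \<open>V = V(n, d - 1)\<close>. The gain over
  the greedy bound \<open>n! / V\<close> comes from sparse neighbourhoods. If \<open>\<sigma>\<close>, \<open>\<tau>\<close> and the identity are
  pairwise at distance less than \<open>d\<close> and \<open>\<sigma>\<close>, \<open>\<tau>\<close> move almost \<open>d\<close> points each, then the sets of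
  moved points share about \<open>d / 2\<close> points, whereas two random \<open>d\<close>-sets share about
  \<open>d\<^sup>2 / n < d / 2\<close>. A binomial moment bound shows that such pairs are an exponentially small
  fraction \<open>1 / g\<^sup>2\<close> of all \<open>V\<^sup>2\<close> pairs.

  For such a graph take a random independent set \<open>W\<close> drawn with probability proportional to
  \<open>l ^ |W|\<close>, \<open>l = g / V\<close>. Conditioning on \<open>W\<close> outside the closed neighbourhood of a vertex \<open>v\<close>,
  either few neighbours of \<open>v\<close> are available and \<open>v\<close> is likely to be in \<open>W\<close>, or many are available
  and, these spanning few edges, \<open>W\<close> contains many of them. Averaging over \<open>v\<close> yields an
  independent set larger than \<open>n! / V\<close> by a factor of order \<open>ln g\<close>, which is linear in \<open>n\<close>.
\<close>

section \<open>Independent sets in locally sparse graphs\<close>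

lemma ex_le_of_weighted_sum_le:
  fixes w f :: "'a \<Rightarrow> real"
  assumes "finite A" "A \<noteq> {}" "\<And>x. x \<in> A \<Longrightarrow> 0 < w x"
    and average: "c * (\<Sum>x\<in>A. w x) \<le> (\<Sum>x\<in>A. w x * f x)"
  shows "\<exists>x\<in>A. c \<le> f x"
proof (rule ccontr)
  assume "\<not> ?thesis"
  then have "(\<Sum>x\<in>A. w x * f x) < (\<Sum>x\<in>A. w x * c)"
    using assms by (intro sum_strict_mono) (auto simp: not_le)
  with average show False
    by (simp add: sum_distrib_left mult.commute)
qed

lemma ln_mult_le_of_le_sqrt:
  fixes g x :: real
  assumes "1 \<le> g" "0 \<le> x" "x \<le> 2 * sqrt g"
  shows "ln g * x \<le> 4 * g"
proof -
  have "ln (sqrt g) \<le> sqrt g"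
    using assms by (intro ln_bound) auto
  then have "ln g \<le> 2 * sqrt g"
    using assms by (simp add: ln_sqrt)
  then have "ln g * x \<le> (2 * sqrt g) * (2 * sqrt g)"
    using assms by (intro mult_mono) auto
  then show ?thesis
    using assms by simp
qed

locale simple_graph =
  fixes adj :: "'a \<Rightarrow> 'a \<Rightarrow> bool"
  assumes irrefl: "\<not> adj x x" and sym: "adj x y \<Longrightarrow> adj y x"
begin

definition nbhd :: "'a set \<Rightarrow> 'a \<Rightarrow> 'a set" where
  "nbhd F v = {u \<in> F. adj v u}"

definition arcs :: "'a set \<Rightarrow> ('a \<times> 'a) set" where
  "arcs F = Sigma F (nbhd F)"

definition indep :: "'a set \<Rightarrow> bool" where
  "indep S \<longleftrightarrow> (\<forall>x\<in>S. \<forall>y\<in>S. \<not> adj x y)"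

definition indeps :: "'a set \<Rightarrow> 'a set set" where
  "indeps F = {S. S \<subseteq> F \<and> indep S}"

definition available :: "'a set \<Rightarrow> 'a set \<Rightarrow> 'a set" where
  "available U J = {u \<in> U. \<forall>w\<in>J. \<not> adj u w}"

definition partition_function :: "real \<Rightarrow> 'a set \<Rightarrow> real" where
  "partition_function l F = (\<Sum>S\<in>indeps F. l ^ card S)"

definition total_occupancy :: "real \<Rightarrow> 'a set \<Rightarrow> real" where
  "total_occupancy l F = (\<Sum>S\<in>indeps F. l ^ card S * card S)"

definition local_occupancy :: "real \<Rightarrow> 'a set \<Rightarrow> 'a set \<Rightarrow> 'a \<Rightarrow> real" where
  "local_occupancy a V W v = a * of_bool (v \<in> W) + card (W \<inter> nbhd V v)"

lemma nbhd_subset: "nbhd F v \<subseteq> F"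
  by (auto simp: nbhd_def)

lemma self_notin_nbhd: "v \<notin> nbhd F v"
  using irrefl by (simp add: nbhd_def)

lemma finite_nbhd: "finite F \<Longrightarrow> finite (nbhd F v)"
  using nbhd_subset finite_subset by blast

lemma finite_arcs: "finite F \<Longrightarrow> finite (arcs F)"
  by (simp add: arcs_def finite_nbhd)

lemma card_arcs:
  assumes "finite F"
  shows "card (arcs F) = (\<Sum>u\<in>F. card (nbhd F u))"
  unfolding arcs_def using assms finite_nbhd by (intro card_SigmaI) auto

lemma card_arcs_mono:
  assumes "finite G" "F \<subseteq> G"
  shows "card (arcs F) \<le> card (arcs G)"
  using assms by (intro card_mono finite_arcs) (auto simp: arcs_def nbhd_def)

lemma finite_indeps: "finite F \<Longrightarrow> finite (indeps F)"
  unfolding indeps_def by (rule finite_subset[of _ "Pow F"]) auto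

lemma indeps_nonempty: "indeps F \<noteq> {}"
  by (auto simp: indeps_def indep_def)

lemma indeps_empty: "indeps {} = {{}}"
  by (auto simp: indeps_def indep_def)

lemma available_subset: "available U J \<subseteq> U"
  by (auto simp: available_def)

lemma finite_available: "finite U \<Longrightarrow> finite (available U J)"
  using available_subset finite_subset by blast

lemma sum_indeps_split:
  assumes "finite V" "U \<subseteq> V"
  shows "(\<Sum>W\<in>indeps V. h W) = (\<Sum>J\<in>indeps (V - U). \<Sum>S\<in>indeps (available U J). h (J \<union> S))"
proof -
  have fin: "finite (indeps (V - U))" "finite (indeps (available U J))" for J
    using assms finite_subset by (auto intro!: finite_indeps finite_available)
  have "(\<Sum>W\<in>indeps V. h W)
      = (\<Sum>(J, S)\<in>(SIGMA J:indeps (V - U). indeps (available U J)). h (J \<union> S))"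
  proof (rule sum.reindex_bij_witness[of _ "\<lambda>(J, S). J \<union> S" "\<lambda>W. (W - U, W \<inter> U)"])
    fix W assume W: "W \<in> indeps V"
    show "(W - U, W \<inter> U) \<in> (SIGMA J:indeps (V - U). indeps (available U J))"
      using W by (auto simp: indeps_def indep_def available_def)
    show "(case (W - U, W \<inter> U) of (J, S) \<Rightarrow> J \<union> S) = W"
      by auto
    show "(case (W - U, W \<inter> U) of (J, S) \<Rightarrow> h (J \<union> S)) = h W"
      by (simp add: Un_Diff_Int)
  next
    fix JS assume JS: "JS \<in> (SIGMA J:indeps (V - U). indeps (available U J))"
    then obtain J S where eq: "JS = (J, S)" and J: "J \<subseteq> V - U" "indep J"
      and S: "S \<subseteq> available U J" "indep S"
      by (auto simp: indeps_def)
    have "indep (J \<union> S)"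
      using J S sym unfolding indep_def available_def by blast
    then show "(case JS of (J, S) \<Rightarrow> J \<union> S) \<in> indeps V"
      using J S assms eq available_subset[of U J] by (auto simp: indeps_def)
    show "((case JS of (J, S) \<Rightarrow> J \<union> S) - U, (case JS of (J, S) \<Rightarrow> J \<union> S) \<inter> U) = JS"
      using J S available_subset[of U J] eq by auto
  qed
  also have "\<dots> = (\<Sum>J\<in>indeps (V - U). \<Sum>S\<in>indeps (available U J). h (J \<union> S))"
    by (rule sum.Sigma[symmetric]) (use fin in auto)
  finally show ?thesis .
qed

lemma sum_indeps_remove:
  assumes "finite F" "u \<in> F"
  shows "(\<Sum>S\<in>indeps F. h S)
           = (\<Sum>S\<in>indeps (F - {u}). h S) + (\<Sum>S\<in>indeps (available (F - {u}) {u}). h (insert u S))"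
proof -
  have "indeps (F - (F - {u})) = {{}, {u}}"
    using assms irrefl by (auto simp: indeps_def indep_def)
  moreover have "available (F - {u}) {} = F - {u}"
    by (auto simp: available_def)
  ultimately show ?thesis
    using sum_indeps_split[of F "F - {u}" h] assms by simp
qed

lemma sum_indeps_insert_dominating:
  assumes "finite F" "v \<notin> F" "\<And>u. u \<in> F \<Longrightarrow> adj v u"
  shows "(\<Sum>S\<in>indeps (insert v F). h S) = h {v} + (\<Sum>S\<in>indeps F. h S)"
proof -
  have "available F {v} = {}"
    using assms(3) sym by (auto simp: available_def)
  then show ?thesis
    using sum_indeps_remove[of "insert v F" v h] assms by (simp add: indeps_empty add.commute)
qed

lemma card_insert_available:
  assumes "finite F" "u \<in> F" "S \<in> indeps (available (F - {u}) {u})"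
  shows "card (insert u S) = Suc (card S)"
proof -
  have "S \<subseteq> F - {u}"
    using assms(3) available_subset unfolding indeps_def by blast
  then show ?thesis
    using assms(1) finite_subset[of S F] by (subst card_insert_disjoint) auto
qed

lemma partition_function_remove:
  assumes "finite F" "u \<in> F"
  shows "partition_function l F
           = partition_function l (F - {u}) + l * partition_function l (available (F - {u}) {u})"
  unfolding partition_function_def sum_indeps_remove[OF assms]
  using card_insert_available[OF assms] by (simp add: sum_distrib_left)

lemma partition_function_mono:
  assumes "finite G" "F \<subseteq> G" "0 \<le> l"
  shows "partition_function l F \<le> partition_function l G"
  unfolding partition_function_def
  by (rule sum_mono2) (use assms finite_indeps in \<open>auto simp: indeps_def\<close>)

lemma partition_function_empty: "partition_function l {} = 1"
  by (simp add: partition_function_def indeps_empty)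

lemma partition_function_ge_1:
  assumes "finite F" "0 \<le> l"
  shows "1 \<le> partition_function l F"
  using partition_function_mono[OF assms(1) empty_subsetI assms(2)]
  by (simp add: partition_function_empty)

lemma partition_function_insert_le:
  assumes "finite F" "0 \<le> l"
  shows "partition_function l (insert u F) \<le> (1 + l) * partition_function l F"
proof (cases "u \<in> F")
  case True
  then show ?thesis
    using partition_function_ge_1[OF assms] assms by (simp add: insert_absorb algebra_simps)
next
  case False
  then have "partition_function l (insert u F)
      = partition_function l F + l * partition_function l (available F {u})"
    using partition_function_remove[of "insert u F" u l] assms by simp
  also have "\<dots> \<le> partition_function l F + l * partition_function l F"
    using assms available_subset
    by (intro add_left_mono mult_left_mono partition_function_mono) auto
  finally show ?thesis
    by (simp add: algebra_simps)
qed

lemma partition_function_Un_le_exp: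
  fixes l :: real
  assumes "finite A" "finite B" "0 \<le> l"
  shows "partition_function l (A \<union> B) \<le> exp (l * card B) * partition_function l A"
  using assms(2)
proof (induction B rule: finite_induct)
  case empty
  then show ?case by simp
next
  case (insert u B)
  have "partition_function l (A \<union> insert u B) \<le> (1 + l) * partition_function l (A \<union> B)"
    using partition_function_insert_le[of "A \<union> B" l u] insert assms by simp
  also have "\<dots> \<le> exp l * (exp (l * card B) * partition_function l A)"
    using insert assms partition_function_ge_1[of "A \<union> B" l] by (intro mult_mono) auto
  also have "\<dots> = exp (l * card (insert u B)) * partition_function l A"
    using insert by (simp add: exp_add algebra_simps)
  finally show ?case .
qed

lemma partition_function_le_exp:
  fixes l :: real
  assumes "finite F" "0 \<le> l"
  shows "partition_function l F \<le> exp (l * card F)"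
  using partition_function_Un_le_exp[of "{}" F l] assms by (simp add: partition_function_empty)

lemma total_occupancy_nonneg: "0 \<le> l \<Longrightarrow> 0 \<le> total_occupancy l F"
  unfolding total_occupancy_def by (intro sum_nonneg) auto

lemma total_occupancy_eq:
  assumes "finite F"
  shows "total_occupancy l F = l * (\<Sum>u\<in>F. partition_function l (available (F - {u}) {u}))"
proof -
  have "total_occupancy l F = (\<Sum>S\<in>indeps F. \<Sum>u\<in>F. of_bool (u \<in> S) * l ^ card S)"
    unfolding total_occupancy_def
  proof (rule sum.cong[OF refl])
    fix S assume "S \<in> indeps F"
    then have "F \<inter> S = S"
      by (auto simp: indeps_def)
    then show "l ^ card S * card S = (\<Sum>u\<in>F. of_bool (u \<in> S) * l ^ card S)"
      using assms by (simp flip: sum_distrib_right)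
  qed
  also have "\<dots> = (\<Sum>u\<in>F. \<Sum>S\<in>indeps F. of_bool (u \<in> S) * l ^ card S)"
    by (rule sum.swap)
  also have "\<dots> = (\<Sum>u\<in>F. l * partition_function l (available (F - {u}) {u}))"
  proof (rule sum.cong[OF refl])
    fix u assume u: "u \<in> F"
    have "(\<Sum>S\<in>indeps (F - {u}). of_bool (u \<in> S) * l ^ card S) = 0"
      by (rule sum.neutral) (auto simp: indeps_def)
    then show "(\<Sum>S\<in>indeps F. of_bool (u \<in> S) * l ^ card S)
        = l * partition_function l (available (F - {u}) {u})"
      unfolding sum_indeps_remove[OF assms u] partition_function_def
      using card_insert_available[OF assms u] by (simp add: sum_distrib_left)
  qed
  finally show ?thesis
    by (simp add: sum_distrib_left)
qed

lemma partition_function_available_ge: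
  fixes l :: real
  assumes "finite F" "u \<in> F" "0 \<le> l"
  shows "exp (- (1 + l)) * (2 - l * card (nbhd F u)) * partition_function l F
           \<le> partition_function l (available (F - {u}) {u})"
proof -
  let ?A = "available (F - {u}) {u}" and ?D = "insert u (nbhd F u)"
  let ?t = "1 - l * card (nbhd F u)"
  have "?A \<union> ?D = F"
    using assms(2) sym by (auto simp: available_def nbhd_def)
  moreover have "card ?D = Suc (card (nbhd F u))"
    using assms by (simp add: finite_nbhd self_notin_nbhd)
  ultimately have Z: "partition_function l F \<le> exp (1 + l - ?t) * partition_function l ?A"
    using partition_function_Un_le_exp[of ?A ?D l] assms
    by (simp add: finite_available finite_nbhd algebra_simps)
  \<comment> \<open>Replacing the exponential by its tangent makes the bound linear in the degree.\<close>
  have "exp (- (1 + l)) * (1 + ?t) * partition_function l F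
      \<le> exp (- (1 + l)) * exp ?t * partition_function l F"
    using assms partition_function_ge_1[of F l] exp_ge_add_one_self[of ?t]
    by (intro mult_right_mono mult_left_mono) auto
  also have "\<dots> \<le> exp (- (1 + l)) * exp ?t * (exp (1 + l - ?t) * partition_function l ?A)"
    using Z by (intro mult_left_mono) auto
  also have "\<dots> = partition_function l ?A"
    by (simp flip: mult.assoc exp_add)
  finally show ?thesis
    by simp
qed

lemma total_occupancy_ge:
  fixes l :: real
  assumes "finite F" "0 \<le> l"
  shows "exp (- (1 + l)) * l * (2 * card F - l * card (arcs F)) * partition_function l F
           \<le> total_occupancy l F"
proof -
  have "exp (- (1 + l)) * l * (2 * card F - l * card (arcs F)) * partition_function l F
      = l * (\<Sum>u\<in>F. exp (- (1 + l)) * (2 - l * card (nbhd F u)) * partition_function l F)"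
    by (simp add: card_arcs[OF assms(1)] sum_subtractf flip: sum_distrib_left sum_distrib_right)
  also have "\<dots> \<le> l * (\<Sum>u\<in>F. partition_function l (available (F - {u}) {u}))"
    using assms by (intro mult_left_mono sum_mono partition_function_available_ge)
  also have "\<dots> = total_occupancy l F"
    by (rule total_occupancy_eq[OF assms(1), symmetric])
  finally show ?thesis .
qed

lemma total_occupancy_ge_ln_partition_function:
  fixes l :: real
  assumes F: "finite F" and l: "0 < l" "l \<le> 1"
    and sparse: "l\<^sup>2 * card (arcs F) \<le> 1" and large: "1 \<le> ln (partition_function l F)"
  shows "exp (- 2) * ln (partition_function l F) * partition_function l F \<le> total_occupancy l F"
proof -
  let ?Z = "partition_function l F"
  have Z_ge_1: "1 \<le> ?Z"
    using F l by (intro partition_function_ge_1) auto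
  have "ln ?Z \<le> ln (exp (l * card F))"
    using Z_ge_1 partition_function_le_exp[OF F, of l] l by (subst ln_le_cancel_iff) auto
  then have ln_Z_le: "ln ?Z \<le> l * card F"
    by simp
  have "l * (l * card (arcs F)) \<le> l * card F"
    using sparse large ln_Z_le by (simp add: power2_eq_square)
  then have arcs_le: "l * card (arcs F) \<le> card F"
    using l by simp
  have "exp (- 2) * ln ?Z * ?Z \<le> exp (- (1 + l)) * (l * (2 * card F - l * card (arcs F))) * ?Z"
  proof (intro mult_right_mono mult_mono)
    show "ln ?Z \<le> l * (2 * card F - l * card (arcs F))"
      using arcs_le l by (intro order_trans[OF ln_Z_le] mult_left_mono) auto
  qed (use l large Z_ge_1 in auto)
  also have "\<dots> \<le> total_occupancy l F"
    using total_occupancy_ge[OF F, of l] l by (simp add: mult.assoc)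
  finally show ?thesis .
qed

lemma total_occupancy_tradeoff:
  fixes l g :: real
  assumes F: "finite F" and l: "0 < l" "l \<le> 1" and g: "exp 2 \<le> g"
    and sparse: "l\<^sup>2 * card (arcs F) \<le> 1"
  shows "exp (- 2) / 4 * ln g * (l + partition_function l F) \<le> g + total_occupancy l F"
proof -
  let ?Z = "partition_function l F"
  have g_gt_1: "1 < g"
    using g exp_gt_one[of "2::real"] by linarith
  have ln_g: "2 \<le> ln g"
    using g g_gt_1 by (simp add: ln_ge_iff)
  have Z_ge_1: "1 \<le> ?Z"
    using F l by (intro partition_function_ge_1) auto
  have occ_nonneg: "0 \<le> total_occupancy l F"
    using l by (intro total_occupancy_nonneg) auto
  show ?thesis
  proof (cases "?Z \<le> sqrt g")
    case True
    then have "ln g * (l + ?Z) \<le> 4 * g"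
      using l Z_ge_1 g_gt_1 by (intro ln_mult_le_of_le_sqrt) auto
    then have "exp (- 2) * (ln g * (l + ?Z)) \<le> 1 * (4 * g)"
      by (rule mult_mono[rotated]) (use l Z_ge_1 ln_g in auto)
    then show ?thesis
      using occ_nonneg by simp
  next
    case False
    then have ln_Z: "ln g / 2 \<le> ln ?Z"
      using g_gt_1 Z_ge_1 ln_le_cancel_iff[of "sqrt g" ?Z] by (simp add: ln_sqrt)
    have "exp (- 2) / 4 * ln g * (l + ?Z) \<le> exp (- 2) / 4 * ln g * (2 * ?Z)"
      using l Z_ge_1 ln_g by (intro mult_left_mono) auto
    also have "\<dots> = exp (- 2) * (ln g / 2) * ?Z"
      by simp
    also have "\<dots> \<le> exp (- 2) * ln ?Z * ?Z"
      using ln_Z Z_ge_1 by (intro mult_right_mono mult_left_mono) auto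
    also have "\<dots> \<le> total_occupancy l F"
      using ln_Z ln_g by (intro total_occupancy_ge_ln_partition_function F l sparse) linarith
    finally show ?thesis
      using g_gt_1 by linarith
  qed
qed

lemma sum_indeps_local_nonneg:
  fixes f :: "'a set \<Rightarrow> real"
  assumes V: "finite V" "U \<subseteq> V" and l: "0 \<le> l"
    and local: "\<And>J. J \<in> indeps (V - U) \<Longrightarrow> 0 \<le> (\<Sum>S\<in>indeps (available U J). l ^ card S * f S)"
  shows "0 \<le> (\<Sum>W\<in>indeps V. l ^ card W * f (W \<inter> U))"
proof -
  have "(\<Sum>S\<in>indeps (available U J). l ^ card (J \<union> S) * f ((J \<union> S) \<inter> U))
      = l ^ card J * (\<Sum>S\<in>indeps (available U J). l ^ card S * f S)"
    if J: "J \<in> indeps (V - U)" for J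
    unfolding sum_distrib_left
  proof (rule sum.cong[OF refl])
    fix S assume "S \<in> indeps (available U J)"
    then have S: "S \<subseteq> U"
      using available_subset[of U J] by (auto simp: indeps_def)
    have "J \<subseteq> V" "J \<inter> U = {}"
      using J by (auto simp: indeps_def)
    then have "card (J \<union> S) = card J + card S" "(J \<union> S) \<inter> U = S"
      using S V finite_subset[of _ V] by (auto intro!: card_Un_disjoint)
    then show "l ^ card (J \<union> S) * f ((J \<union> S) \<inter> U) = l ^ card J * (l ^ card S * f S)"
      by (simp add: power_add)
  qed
  then show ?thesis
    unfolding sum_indeps_split[OF V]
    using local l by (simp add: sum_nonneg)
qed

lemma sum_indeps_dominating_nonneg:
  fixes l g :: real
  assumes F: "finite F" "v \<notin> F" "\<And>u. u \<in> F \<Longrightarrow> adj v u"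
    and l: "0 < l" "l \<le> 1" and g: "exp 2 \<le> g" and sparse: "l\<^sup>2 * card (arcs F) \<le> 1"
  shows "0 \<le> (\<Sum>S\<in>indeps (insert v F).
    l ^ card S * (g / l * of_bool (v \<in> S) + card (S - {v}) - exp (- 2) / 4 * ln g))"
proof -
  define L where "L = exp (- 2) / 4 * ln g"
  define f where "f S = g / l * of_bool (v \<in> S) + card (S - {v}) - L" for S
  have "(\<Sum>S\<in>indeps F. l ^ card S * f S) = (\<Sum>S\<in>indeps F. l ^ card S * card S - L * l ^ card S)"
  proof (rule sum.cong[OF refl])
    fix S assume "S \<in> indeps F"
    then have "v \<notin> S"
      using F(2) by (auto simp: indeps_def)
    then show "l ^ card S * f S = l ^ card S * card S - L * l ^ card S"
      by (simp add: f_def algebra_simps)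
  qed
  also have "\<dots> = total_occupancy l F - L * partition_function l F"
    by (simp add: total_occupancy_def partition_function_def sum_subtractf sum_distrib_left)
  moreover have "l ^ card {v} * f {v} = g - L * l"
    using l by (simp add: f_def algebra_simps)
  ultimately have "(\<Sum>S\<in>indeps (insert v F). l ^ card S * f S)
      = g + total_occupancy l F - L * (l + partition_function l F)"
    using sum_indeps_insert_dominating[of F v "\<lambda>S. l ^ card S * f S"] F
    by (simp add: algebra_simps)
  then show ?thesis
    using total_occupancy_tradeoff[OF F(1) l g sparse] by (simp add: f_def L_def)
qed

lemma available_closed_nbhd:
  assumes "J \<in> indeps (V - insert v (nbhd V v))"
  shows "available (insert v (nbhd V v)) J = insert v (available (nbhd V v) J)"
  using assms by (auto simp: available_def nbhd_def indeps_def)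

lemma local_occupancy_closed_nbhd:
  "local_occupancy a V W v
     = a * of_bool (v \<in> W \<inter> insert v (nbhd V v)) + card (W \<inter> insert v (nbhd V v) - {v})"
proof -
  have "W \<inter> insert v (nbhd V v) - {v} = W \<inter> nbhd V v"
    using self_notin_nbhd[of v V] by auto
  then show ?thesis
    by (simp add: local_occupancy_def)
qed

lemma weighted_local_occupancy_ge:
  fixes l g :: real
  assumes V: "finite V" "v \<in> V" and l: "0 < l" "l \<le> 1" and g: "exp 2 \<le> g"
    and sparse: "l\<^sup>2 * card (arcs (nbhd V v)) \<le> 1"
  shows "exp (- 2) / 4 * ln g * partition_function l V
           \<le> (\<Sum>W\<in>indeps V. l ^ card W * local_occupancy (g / l) V W v)"
proof -
  let ?N = "nbhd V v"
  define L where "L = exp (- 2) / 4 * ln g"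
  define f where "f S = g / l * of_bool (v \<in> S) + card (S - {v}) - L" for S
  have "0 \<le> (\<Sum>S\<in>indeps (available (insert v ?N) J). l ^ card S * f S)"
    if J: "J \<in> indeps (V - insert v ?N)" for J
  proof -
    have "l\<^sup>2 * card (arcs (available ?N J)) \<le> l\<^sup>2 * card (arcs ?N)"
      using V by (intro mult_left_mono of_nat_mono card_arcs_mono available_subset)
        (auto simp: finite_nbhd)
    then have "l\<^sup>2 * card (arcs (available ?N J)) \<le> 1"
      using sparse by simp
    moreover have "finite (available ?N J)"
      using V by (simp add: finite_available finite_nbhd)
    moreover have "v \<notin> available ?N J" "\<And>u. u \<in> available ?N J \<Longrightarrow> adj v u"
      using irrefl by (auto simp: available_def nbhd_def)
    ultimately show ?thesis
      unfolding f_def L_def available_closed_nbhd[OF J]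
      using sum_indeps_dominating_nonneg[OF _ _ _ l g] by presburger
  qed
  then have "0 \<le> (\<Sum>W\<in>indeps V. l ^ card W * f (W \<inter> insert v ?N))"
    using V l nbhd_subset[of V v] by (intro sum_indeps_local_nonneg) auto
  then have "0 \<le> (\<Sum>W\<in>indeps V. l ^ card W * (local_occupancy (g / l) V W v - L))"
    by (simp add: f_def local_occupancy_closed_nbhd)
  then have "L * partition_function l V
      \<le> (\<Sum>W\<in>indeps V. l ^ card W * local_occupancy (g / l) V W v)"
    by (simp add: partition_function_def sum_distrib_left sum_subtractf mult.commute
        right_diff_distrib)
  then show ?thesis
    by (simp only: L_def)
qed

lemma sum_card_Int_nbhd:
  assumes "finite V" "W \<subseteq> V"
  shows "(\<Sum>v\<in>V. card (W \<inter> nbhd V v)) = (\<Sum>w\<in>W. card (nbhd V w))"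
proof -
  have "W \<inter> nbhd V v = {w \<in> W. adj v w}" for v
    using assms(2) by (auto simp: nbhd_def)
  moreover have "nbhd V w = {v \<in> V. adj v w}" for w
    using sym by (auto simp: nbhd_def)
  moreover have "(\<Sum>v\<in>V. card {w \<in> W. adj v w}) = (\<Sum>w\<in>W. card {v \<in> V. adj v w})"
    using assms finite_subset by (intro sum_multicount_gen) auto
  ultimately show ?thesis
    by (simp only:)
qed

lemma sum_local_occupancy_le:
  fixes \<Delta> :: real
  assumes V: "finite V" "W \<subseteq> V" and deg: "\<And>v. v \<in> V \<Longrightarrow> card (nbhd V v) \<le> \<Delta>"
  shows "(\<Sum>v\<in>V. local_occupancy \<Delta> V W v) \<le> 2 * \<Delta> * card W"
proof -
  have "(\<Sum>v\<in>V. card (W \<inter> nbhd V v)) = (\<Sum>w\<in>W. real (card (nbhd V w)))"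
    using sum_card_Int_nbhd[OF V] by (simp flip: of_nat_sum)
  also have "\<dots> \<le> \<Delta> * card W"
    using sum_bounded_above[of W "\<lambda>w. real (card (nbhd V w))" \<Delta>] V deg
    by (auto simp: mult.commute)
  finally have "(\<Sum>v\<in>V. real (card (W \<inter> nbhd V v))) \<le> \<Delta> * card W"
    by simp
  moreover have "V \<inter> W = W"
    using V by auto
  ultimately show ?thesis
    using V by (simp add: local_occupancy_def sum.distrib flip: sum_distrib_left)
qed

lemma large_indep_of_locally_sparse:
  fixes g \<Delta> :: real
  assumes V: "finite V" and g: "exp 2 \<le> g" "g \<le> \<Delta>"
    and deg: "\<And>v. v \<in> V \<Longrightarrow> card (nbhd V v) \<le> \<Delta>"
    and sparse: "\<And>v. v \<in> V \<Longrightarrow> g\<^sup>2 * card (arcs (nbhd V v)) \<le> \<Delta>\<^sup>2"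
  obtains I where "I \<subseteq> V" "indep I" "exp (- 2) / 4 * ln g * card V \<le> 2 * \<Delta> * card I"
proof -
  define l where "l = g / \<Delta>"
  let ?L = "exp (- 2) / 4 * ln g"
  have "0 < g"
    using g(1) exp_gt_zero[of "2::real"] by linarith
  then have l: "0 < l" "l \<le> 1" "g / l = \<Delta>"
    using g by (auto simp: l_def)
  have l_sparse: "l\<^sup>2 * card (arcs (nbhd V v)) \<le> 1" if "v \<in> V" for v
    using sparse[OF that] \<open>0 < g\<close> g by (simp add: l_def power_divide)
  have "?L * card V * (\<Sum>W\<in>indeps V. l ^ card W) = (\<Sum>v\<in>V. ?L * partition_function l V)"
    by (simp add: partition_function_def)
  also have "\<dots> \<le> (\<Sum>v\<in>V. \<Sum>W\<in>indeps V. l ^ card W * local_occupancy \<Delta> V W v)"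
    using weighted_local_occupancy_ge[OF V _ l(1,2) g(1) l_sparse] l(3) by (intro sum_mono) auto
  also have "\<dots> = (\<Sum>W\<in>indeps V. l ^ card W * (\<Sum>v\<in>V. local_occupancy \<Delta> V W v))"
    by (subst sum.swap) (simp add: sum_distrib_left)
  finally have "\<exists>W\<in>indeps V. ?L * card V \<le> (\<Sum>v\<in>V. local_occupancy \<Delta> V W v)"
    by (intro ex_le_of_weighted_sum_le) (use V l finite_indeps indeps_nonempty in auto)
  then obtain I where I: "I \<in> indeps V" "?L * card V \<le> (\<Sum>v\<in>V. local_occupancy \<Delta> V I v)" ..
  moreover have "(\<Sum>v\<in>V. local_occupancy \<Delta> V I v) \<le> 2 * \<Delta> * card I"
    using V I(1) deg by (intro sum_local_occupancy_le) (auto simp: indeps_def)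
  ultimately show ?thesis
    using that by (auto simp: indeps_def)
qed

end

section \<open>Hamming balls of permutations\<close>

definition moved :: "('a \<Rightarrow> 'a) \<Rightarrow> 'a set" where
  "moved p = {i. p i \<noteq> i}"

definition perm_dist :: "('a \<Rightarrow> 'b) \<Rightarrow> ('a \<Rightarrow> 'b) \<Rightarrow> nat" where
  "perm_dist p q = card {i. p i \<noteq> q i}"

definition perm_ball :: "'a set \<Rightarrow> nat \<Rightarrow> ('a \<Rightarrow> 'a) set" where
  "perm_ball A r = {p. p permutes A \<and> card (moved p) \<le> r}"

definition close_pairs :: "'a set \<Rightarrow> nat \<Rightarrow> (('a \<Rightarrow> 'a) \<times> ('a \<Rightarrow> 'a)) set" where
  "close_pairs A r = {(p, q). p \<in> perm_ball A r \<and> q \<in> perm_ball A r \<and> perm_dist p q \<le> r}"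

definition far_close :: "'a set \<Rightarrow> nat \<Rightarrow> nat \<Rightarrow> ('a \<Rightarrow> 'a) \<Rightarrow> ('a \<Rightarrow> 'a) set" where
  "far_close A s r p = {q \<in> perm_ball A r. s < card (moved q) \<and> perm_dist p q \<le> r}"

lemma perm_dist_comp_inj: "inj f \<Longrightarrow> perm_dist (f \<circ> p) (f \<circ> q) = perm_dist p q"
  by (simp add: perm_dist_def inj_eq)

lemma finite_perm_ball: "finite A \<Longrightarrow> finite (perm_ball A r)"
  unfolding perm_ball_def by (rule finite_subset[OF _ finite_permutations[of A]]) auto

lemma finite_close_pairs: "finite A \<Longrightarrow> finite (close_pairs A r)"
  by (rule finite_subset[of _ "perm_ball A r \<times> perm_ball A r"])
    (auto simp: close_pairs_def finite_perm_ball)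

lemma moved_subset: "p permutes A \<Longrightarrow> moved p \<subseteq> A"
  by (auto simp: moved_def permutes_def)

lemma permutes_moved: "p permutes A \<Longrightarrow> p permutes moved p"
  by (auto simp: permutes_def moved_def)

lemma id_in_perm_ball: "id \<in> perm_ball A r"
  by (simp add: perm_ball_def moved_def permutes_id)

lemma id_id_in_close_pairs: "(id, id) \<in> close_pairs A r"
  by (simp add: close_pairs_def perm_dist_def id_in_perm_ball)

lemma card_permutes_moved_eq:
  assumes "finite A" "B \<subseteq> A"
  shows "card {p. p permutes A \<and> moved p = B} = num_derangements (card B)"
proof -
  have "finite B"
    using assms finite_subset by blast
  then obtain f where "bij_betw f {1..card B} B"
    using finite_same_card_bij[of "{1..card B}" B] by auto
  from bij_betw_same_card[OF bij_betw_derangements[OF this]]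
  have "num_derangements (card B) = card {p. p permutes B \<and> (\<forall>x\<in>B. p x \<noteq> x)}"
    by (simp add: num_derangements_def sym_perms_def)
  also have "{p. p permutes B \<and> (\<forall>x\<in>B. p x \<noteq> x)} = {p. p permutes A \<and> moved p = B}"
  proof (intro Collect_cong iffI; elim conjE)
    fix p assume p: "p permutes B" "\<forall>x\<in>B. p x \<noteq> x"
    then show "p permutes A \<and> moved p = B"
      using permutes_subset[OF p(1) assms(2)] moved_subset[OF p(1)] by (auto simp: moved_def)
  next
    fix p assume p: "p permutes A" "moved p = B"
    then show "p permutes B \<and> (\<forall>x\<in>B. p x \<noteq> x)"
      using permutes_moved[OF p(1)] by (auto simp: moved_def)
  qed
  finally show ?thesis ..
qed

lemma sum_perm_ball:
  fixes \<phi> :: "'a set \<Rightarrow> nat"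
  assumes A: "finite A"
  shows "(\<Sum>p\<in>perm_ball A r. \<phi> (moved p))
           = (\<Sum>k\<le>r. num_derangements k * (\<Sum>B | B \<subseteq> A \<and> card B = k. \<phi> B))"
proof -
  let ?T = "{B. B \<subseteq> A \<and> card B \<le> r}"
  have "(\<Sum>p\<in>perm_ball A r. \<phi> (moved p))
      = (\<Sum>B\<in>?T. \<Sum>p | p \<in> perm_ball A r \<and> moved p = B. \<phi> (moved p))"
    by (rule sum.group[symmetric])
      (use A finite_perm_ball in \<open>auto simp: perm_ball_def dest!: moved_subset\<close>)
  also have "\<dots> = (\<Sum>B\<in>?T. num_derangements (card B) * \<phi> B)"
  proof (rule sum.cong[OF refl])
    fix B assume B: "B \<in> ?T"
    then have "{p. p \<in> perm_ball A r \<and> moved p = B} = {p. p permutes A \<and> moved p = B}"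
      by (auto simp: perm_ball_def)
    then show "(\<Sum>p | p \<in> perm_ball A r \<and> moved p = B. \<phi> (moved p))
        = num_derangements (card B) * \<phi> B"
      using B card_permutes_moved_eq[OF A] by simp
  qed
  also have "\<dots> = (\<Sum>k\<le>r. \<Sum>B | B \<in> ?T \<and> card B = k. num_derangements (card B) * \<phi> B)"
    by (rule sum.group[symmetric]) (use A in auto)
  also have "\<dots> = (\<Sum>k\<le>r. num_derangements k * (\<Sum>B | B \<subseteq> A \<and> card B = k. \<phi> B))"
    by (auto simp: sum_distrib_left intro!: sum.cong)
  finally show ?thesis .
qed

lemma card_perm_ball:
  assumes "finite A"
  shows "card (perm_ball A r) = sphere_vol (card A) r"
  using sum_perm_ball[OF assms, of "\<lambda>_. 1" r] n_subsets[OF assms]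
  by (simp add: sphere_vol_def mult.commute atMost_atLeast0)

subsection \<open>Binomial moments of intersections\<close>

lemma card_supersets:
  assumes A: "finite A" "M \<subseteq> A" and k: "card M \<le> k"
  shows "card {B. M \<subseteq> B \<and> B \<subseteq> A \<and> card B = k} = (card A - card M choose (k - card M))"
proof -
  have finM: "finite M"
    using A finite_subset by blast
  have "bij_betw (\<lambda>B. B - M) {B. M \<subseteq> B \<and> B \<subseteq> A \<and> card B = k}
          {C. C \<subseteq> A - M \<and> card C = k - card M}"
  proof (rule bij_betw_byWitness[where f' = "\<lambda>C. M \<union> C"])
    show "(\<lambda>C. M \<union> C) ` {C. C \<subseteq> A - M \<and> card C = k - card M}
        \<subseteq> {B. M \<subseteq> B \<and> B \<subseteq> A \<and> card B = k}"
    proof safe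
      fix C assume C: "C \<subseteq> A - M" "card C = k - card M"
      then have "finite C" "M \<inter> C = {}"
        using A finite_subset[of C A] by auto
      then show "card (M \<union> C) = k"
        using C finM k by (simp add: card_Un_disjoint)
    qed (use A in auto)
  qed (use finM in \<open>auto simp: card_Diff_subset\<close>)
  from bij_betw_same_card[OF this] show ?thesis
    using A finM n_subsets[of "A - M" "k - card M"] by (simp add: card_Diff_subset)
qed

lemma sum_choose_card_Int:
  assumes A: "finite A" "S \<subseteq> A" and "m \<le> k"
  shows "(\<Sum>B | B \<subseteq> A \<and> card B = k. card (S \<inter> B) choose m)
           = (card S choose m) * (card A - m choose (k - m))"
proof -
  let ?P = "{B. B \<subseteq> A \<and> card B = k}" and ?Q = "{M. M \<subseteq> S \<and> card M = m}"
  have "finite S"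
    using A finite_subset by blast
  then have fin: "finite S" "finite ?P" "finite ?Q"
    using A by auto
  have "(\<Sum>B\<in>?P. card (S \<inter> B) choose m) = (\<Sum>B\<in>?P. card {M \<in> ?Q. M \<subseteq> B})"
  proof (rule sum.cong[OF refl])
    fix B
    have "{M \<in> ?Q. M \<subseteq> B} = {M. M \<subseteq> S \<inter> B \<and> card M = m}"
      by auto
    then show "(card (S \<inter> B) choose m) = card {M \<in> ?Q. M \<subseteq> B}"
      using fin(1) n_subsets[of "S \<inter> B" m] by simp
  qed
  also have "\<dots> = (card A - m choose (k - m)) * card ?Q"
  proof (rule sum_multicount[OF fin(2,3)], rule ballI)
    fix M assume "M \<in> ?Q"
    moreover have "{B \<in> ?P. M \<subseteq> B} = {B. M \<subseteq> B \<and> B \<subseteq> A \<and> card B = k}"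
      by auto
    ultimately show "card {B \<in> ?P. M \<subseteq> B} = (card A - m choose (k - m))"
      using assms card_supersets[of A M k] by auto
  qed
  finally show ?thesis
    using fin by (simp add: n_subsets)
qed

lemma sum_choose_card_Int_mult_choose:
  assumes A: "finite A" "S \<subseteq> A"
  shows "(\<Sum>B | B \<subseteq> A \<and> card B = k. card (S \<inter> B) choose m) * (card A choose m)
           = (card S choose m) * (k choose m) * (card A choose k)"
proof -
  consider "m \<le> k" "k \<le> card A" | "k < m" | "card A < k"
    by linarith
  then show ?thesis
  proof cases
    assume "m \<le> k" "k \<le> card A"
    then show ?thesis
      using choose_mult[of m k "card A"] by (simp add: sum_choose_card_Int[OF A] mult_ac)
  next
    assume "k < m"
    moreover have "card (S \<inter> B) \<le> card B" if "B \<subseteq> A" for B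
      using that A finite_subset[of B A] by (intro card_mono) auto
    ultimately have "(\<Sum>B | B \<subseteq> A \<and> card B = k. card (S \<inter> B) choose m) = 0"
      by (intro sum.neutral) (auto intro!: binomial_eq_0 intro: order_le_less_trans)
    then show ?thesis
      using \<open>k < m\<close> by simp
  next
    assume "card A < k"
    then have "{B. B \<subseteq> A \<and> card B = k} = {}"
      by (auto dest!: card_mono[OF A(1)])
    then show ?thesis
      using \<open>card A < k\<close> by (simp only: sum.empty binomial_eq_0 mult_0 mult_0_right)
  qed
qed

lemma sum_perm_ball_choose_le:
  assumes A: "finite A" "S \<subseteq> A"
  shows "(\<Sum>p\<in>perm_ball A r. card (S \<inter> moved p) choose m) * (card A choose m)
           \<le> (card S choose m) * (r choose m) * sphere_vol (card A) r"
proof -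
  have "(\<Sum>p\<in>perm_ball A r. card (S \<inter> moved p) choose m) * (card A choose m)
      = (\<Sum>k\<le>r. num_derangements k * (\<Sum>B | B \<subseteq> A \<and> card B = k. card (S \<inter> B) choose m))
          * (card A choose m)"
    using sum_perm_ball[OF A(1), of "\<lambda>B. card (S \<inter> B) choose m" r] by simp
  also have "\<dots>
      = (\<Sum>k\<le>r. num_derangements k * ((card S choose m) * (k choose m) * (card A choose k)))"
    unfolding sum_choose_card_Int_mult_choose[OF A, symmetric] sum_distrib_right[of _ "{..r}"]
    by (simp only: mult.assoc)
  also have "\<dots>
      \<le> (\<Sum>k\<le>r. num_derangements k * ((card S choose m) * (r choose m) * (card A choose k)))"
    by (intro sum_mono mult_left_mono mult_right_mono binomial_right_mono) auto
  also have "\<dots> = (card S choose m) * (r choose m) * sphere_vol (card A) r"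
    unfolding sphere_vol_def sum_distrib_left atMost_atLeast0 by (simp only: mult_ac)
  finally show ?thesis .
qed

lemma binomial_sq_le_of_factors_le:
  fixes \<rho> :: real and k m n r :: nat
  assumes ratio: "\<And>i. i < m \<Longrightarrow> (real r - i)\<^sup>2 \<le> \<rho> * ((real k - i) * (real n - i))"
  shows "(real (r choose m))\<^sup>2 \<le> \<rho> ^ m * (real (k choose m) * real (n choose m))"
proof -
  have choose: "real (a choose m) = (\<Prod>i<m. real a - i) / fact m" for a
    by (simp add: binomial_gbinomial gbinomial_prod_rev atLeast0LessThan)
  have "(\<Prod>i<m. real r - i)\<^sup>2 = (\<Prod>i<m. (real r - i)\<^sup>2)"
    by (rule prod_power_distrib)
  also have "\<dots> \<le> (\<Prod>i<m. \<rho> * ((real k - i) * (real n - i)))"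
    using ratio by (intro prod_mono) auto
  also have "\<dots> = \<rho> ^ m * ((\<Prod>i<m. real k - i) * (\<Prod>i<m. real n - i))"
    by (simp add: prod.distrib)
  finally have "(\<Prod>i<m. real r - i)\<^sup>2 / (fact m)\<^sup>2
      \<le> \<rho> ^ m * ((\<Prod>i<m. real k - i) * (\<Prod>i<m. real n - i)) / (fact m)\<^sup>2"
    by (rule divide_right_mono) simp
  then show ?thesis
    by (simp add: choose power_divide power2_eq_square)
qed

text \<open>For small \<open>m\<close> and \<open>k \<approx> r / 2\<close> the ratio of the factors is about \<open>r\<^sup>2 / (k n) \<approx> 2 \<delta>\<close>; the
  base \<open>4 \<delta> / (1 + 2 \<delta>)\<close> lies between \<open>2 \<delta>\<close> and \<open>1\<close>.\<close>

lemma binomial_sq_le_power_mult_binomials: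
  fixes \<delta> :: real
  assumes \<delta>: "0 < \<delta>" "\<delta> < 1 / 2" and r: "r \<le> \<delta> * n"
    and m: "8 * real m \<le> (1 - 2 * \<delta>) * r" and k: "r \<le> 2 * k + 2 * m"
  shows "(real (r choose m))\<^sup>2
           \<le> (4 * \<delta> / (1 + 2 * \<delta>)) ^ m * (real (k choose m) * real (n choose m))"
proof (rule binomial_sq_le_of_factors_le)
  fix i assume "i < m"
  then have i: "real i \<le> m"
    by simp
  have r_n: "real r - i \<le> \<delta> * (real n - i)"
  proof -
    have "\<delta> * i \<le> 1 * real i"
      using \<delta> by (intro mult_right_mono) auto
    then show ?thesis
      using r by (simp add: algebra_simps)
  qed
  have r_k: "real r - i \<le> 4 / (1 + 2 * \<delta>) * (real k - i)"
  proof -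
    have "real r \<le> 2 * real k + 2 * real m"
      using k by linarith
    moreover have "0 \<le> 2 * \<delta> * i"
      using \<delta> by simp
    ultimately have "(1 + 2 * \<delta>) * (real r - i) \<le> 4 * (real k - i)"
      using m i by (simp add: algebra_simps)
    then show ?thesis
      using \<delta> by (simp add: field_simps)
  qed
  have "(1 - 2 * \<delta>) * r \<le> 1 * real r"
    using \<delta> by (intro mult_right_mono) auto
  then have "0 \<le> real r - i"
    using i m by linarith
  then have "(real r - i)\<^sup>2 \<le> (\<delta> * (real n - i)) * (4 / (1 + 2 * \<delta>) * (real k - i))"
    unfolding power2_eq_square using r_n r_k by (intro mult_mono) auto
  also have "\<dots> = 4 * \<delta> / (1 + 2 * \<delta>) * ((real k - i) * (real n - i))"
    by simp
  finally show "(real r - i)\<^sup>2 \<le> 4 * \<delta> / (1 + 2 * \<delta>) * ((real k - i) * (real n - i))" .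
qed

subsection \<open>Growth of balls\<close>

lemma card_perm_ball_le:
  assumes A: "finite A" "s \<le> card A"
  shows "card (perm_ball A s) \<le> (card A choose s) * fact s"
proof -
  let ?P = "{B. B \<subseteq> A \<and> card B = s}"
  have "perm_ball A s \<subseteq> (\<Union>B\<in>?P. {p. p permutes B})"
  proof
    fix p assume "p \<in> perm_ball A s"
    then have p: "p permutes A" "card (moved p) \<le> s"
      by (auto simp: perm_ball_def)
    obtain B where "moved p \<subseteq> B" "B \<subseteq> A" "card B = s"
      using exists_subset_between[OF p(2) A(2) moved_subset[OF p(1)] A(1)] by blast
    then show "p \<in> (\<Union>B\<in>?P. {p. p permutes B})"
      using permutes_subset[OF permutes_moved[OF p(1)]] by auto
  qed
  moreover have "finite (\<Union>B\<in>?P. {p. p permutes B})"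
    using A by (auto intro!: finite_permutations intro: finite_subset)
  ultimately have "card (perm_ball A s) \<le> card (\<Union>B\<in>?P. {p. p permutes B})"
    by (rule card_mono[rotated])
  also have "\<dots> \<le> (\<Sum>B\<in>?P. card {p. p permutes B})"
    using A by (intro card_UN_le) auto
  also have "\<dots> = (\<Sum>B\<in>?P. fact s)"
    using A by (intro sum.cong refl card_permutations) (auto intro: finite_subset)
  also have "\<dots> = (card A choose s) * fact s"
    using A by (simp add: n_subsets)
  finally show ?thesis .
qed

lemma choose_mult_fact_le_card_perm_ball:
  assumes A: "finite A"
  shows "(card A choose r) * fact r \<le> 2 ^ card A * card (perm_ball A r)"
proof -
  let ?P = "{B. B \<subseteq> A \<and> card B = r}"
  have "(card A choose r) * fact r = (\<Sum>B\<in>?P. card {p. p permutes B})"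
    using A by (simp add: n_subsets card_permutations finite_subset[of _ A])
  also have "\<dots> = card (SIGMA B:?P. {p. p permutes B})"
    using A by (intro card_SigmaI[symmetric]) (auto intro: finite_subset finite_permutations)
  also have "\<dots> \<le> card (Pow A \<times> perm_ball A r)"
  proof (rule card_mono)
    show "(SIGMA B:?P. {p. p permutes B}) \<subseteq> Pow A \<times> perm_ball A r"
    proof safe
      fix B p assume B: "B \<subseteq> A" "r = card B" "p permutes B"
      then have "card (moved p) \<le> card B"
        using A by (intro card_mono moved_subset) (auto intro: finite_subset)
      then show "p \<in> perm_ball A (card B)"
        using B permutes_subset by (auto simp: perm_ball_def)
    qed
  qed (use A in \<open>simp add: finite_perm_ball\<close>)
  also have "\<dots> = 2 ^ card A * card (perm_ball A r)"
    using A by (simp add: card_cartesian_product card_Pow)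
  finally show ?thesis .
qed

lemma fact_mult_power_le:
  assumes "a \<le> b"
  shows "fact a * a ^ (b - a) \<le> (fact b :: nat)"
  using assms
proof (induction b rule: dec_induct)
  case base
  then show ?case
    by simp
next
  case (step b)
  have "fact a * a ^ (Suc b - a) = a * (fact a * a ^ (b - a))"
    using step by (simp add: Suc_diff_le)
  also have "\<dots> \<le> Suc b * fact b"
    using step by (intro mult_mono) auto
  finally show ?case
    by simp
qed

lemma card_perm_ball_mult_power_le:
  assumes A: "finite A" and s_r_n: "s \<le> r" "r \<le> card A"
  shows "card (perm_ball A s) * (card A - r) ^ (r - s) \<le> 2 ^ card A * card (perm_ball A r)"
proof -
  let ?n = "card A"
  have falling: "(?n choose j) * fact j * fact (?n - j) = (fact ?n :: nat)" if "j \<le> ?n" for j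
    using binomial_fact_lemma[OF that] by (simp add: mult_ac)
  have "card (perm_ball A s) * (?n - r) ^ (r - s) * fact (?n - r)
      \<le> (?n choose s) * fact s * (fact (?n - r) * (?n - r) ^ (r - s))"
    using card_perm_ball_le[OF A, of s] s_r_n
      mult_right_mono[of _ _ "fact (?n - r) * (?n - r) ^ (r - s)"]
    by (simp add: mult_ac)
  also have "\<dots> \<le> (?n choose s) * fact s * fact (?n - s)"
    using fact_mult_power_le[of "?n - r" "?n - s"] s_r_n by (intro mult_left_mono) auto
  also have "\<dots> = (?n choose r) * fact r * fact (?n - r)"
    using falling s_r_n by simp
  also have "\<dots> \<le> 2 ^ ?n * card (perm_ball A r) * fact (?n - r)"
    using choose_mult_fact_le_card_perm_ball[OF A] by (intro mult_right_mono) auto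
  finally show ?thesis
    by simp
qed

lemma card_perm_ball_mult_exp_le:
  fixes \<eta> :: real
  assumes A: "finite A" and r: "2 * r \<le> card A" and m: "m \<le> r" "\<eta> * card A \<le> m"
    and \<eta>: "0 < \<eta>" and large: "2 * exp (2 / \<eta>) \<le> card A"
  shows "card (perm_ball A (r - m)) * exp (card A) \<le> card (perm_ball A r)"
proof -
  let ?n = "card A" and ?V = "real (card (perm_ball A r))"
  let ?s = "real (card (perm_ball A (r - m)))"
  have "exp (real ?n) * exp (real ?n) = exp (2 * real ?n)"
    by (simp flip: exp_add)
  also have "\<dots> \<le> exp (2 / \<eta> * m)"
    using m \<eta> by (simp add: field_simps)
  also have "\<dots> = exp (2 / \<eta>) ^ m"
    by (rule exp_of_nat2_mult)
  also have "\<dots> \<le> real (?n - r) ^ m"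
    using large r by (intro power_mono) (auto simp: of_nat_diff)
  finally have "?s * (exp (real ?n) * exp (real ?n)) \<le> ?s * real (?n - r) ^ m"
    by (intro mult_left_mono) auto
  also have "\<dots> = real (card (perm_ball A (r - m)) * (?n - r) ^ (r - (r - m)))"
    using m by simp
  also have "\<dots> \<le> real (2 ^ ?n * card (perm_ball A r))"
    using r by (intro of_nat_mono card_perm_ball_mult_power_le A) auto
  also have "\<dots> \<le> exp 1 ^ ?n * ?V"
    using exp_ge_add_one_self[of "1::real"] by (auto intro!: mult_right_mono power_mono)
  also have "\<dots> = ?V * exp (real ?n)"
    by (simp flip: exp_of_nat2_mult)
  finally show ?thesis
    by (simp flip: mult.assoc)
qed

subsection \<open>Close pairs\<close>

lemma card_moved_add_card_moved_le:
  assumes "finite (moved p)" "finite (moved q)"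
  shows "card (moved p) + card (moved q) \<le> perm_dist p q + 2 * card (moved p \<inter> moved q)"
proof -
  let ?M = "moved p \<union> moved q" and ?I = "moved p \<inter> moved q"
  have "{i. p i \<noteq> q i} \<subseteq> ?M"
    by (auto simp: moved_def)
  then have "finite {i. p i \<noteq> q i}"
    using assms finite_subset by auto
  moreover have "?M - ?I \<subseteq> {i. p i \<noteq> q i}"
    by (auto simp: moved_def)
  ultimately have "card (?M - ?I) \<le> perm_dist p q"
    unfolding perm_dist_def by (rule card_mono)
  moreover have "card (?M \<inter> ?I) + card (?M - ?I) = card ?M"
    using assms by (intro card_Int_Diff[symmetric]) simp
  moreover have "?M \<inter> ?I = ?I"
    by auto
  ultimately show ?thesis
    using card_Un_Int[OF assms] by simp
qed

lemma card_far_close_mult_le: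
  assumes A: "finite A" and p: "p \<in> perm_ball A r" "s < card (moved p)"
    and k: "2 * k + r \<le> 2 * s + 2"
  shows "card (far_close A s r p) * ((k choose m) * (card A choose m))
           \<le> (r choose m)\<^sup>2 * sphere_vol (card A) r"
proof -
  have finite_moved: "finite (moved q)" if "q \<in> perm_ball A r" for q
    using that A moved_subset[of q A] finite_subset by (auto simp: perm_ball_def)
  have "card (far_close A s r p) * (k choose m) = (\<Sum>q\<in>far_close A s r p. k choose m)"
    by simp
  also have "\<dots> \<le> (\<Sum>q\<in>far_close A s r p. card (moved p \<inter> moved q) choose m)"
  proof (intro sum_mono binomial_right_mono)
    fix q assume q: "q \<in> far_close A s r p"
    then show "k \<le> card (moved p \<inter> moved q)"
      using card_moved_add_card_moved_le[of p q] finite_moved p k by (auto simp: far_close_def)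
  qed
  also have "\<dots> \<le> (\<Sum>q\<in>perm_ball A r. card (moved p \<inter> moved q) choose m)"
    using finite_perm_ball[OF A] by (intro sum_mono2) (auto simp: far_close_def)
  finally have "card (far_close A s r p) * (k choose m) * (card A choose m)
      \<le> (\<Sum>q\<in>perm_ball A r. card (moved p \<inter> moved q) choose m) * (card A choose m)"
    by (intro mult_right_mono) auto
  also have "\<dots> \<le> (card (moved p) choose m) * (r choose m) * sphere_vol (card A) r"
    using p A by (intro sum_perm_ball_choose_le moved_subset) (auto simp: perm_ball_def)
  also have "\<dots> \<le> (r choose m) * (r choose m) * sphere_vol (card A) r"
    using p by (intro mult_right_mono binomial_right_mono) (auto simp: perm_ball_def)
  finally show ?thesis
    by (simp add: power2_eq_square mult_ac)
qed

lemma card_far_close_le: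
  fixes \<delta> :: real
  assumes A: "finite A" and \<delta>: "0 < \<delta>" "\<delta> < 1 / 2" and r: "r \<le> \<delta> * card A"
    and m: "8 * real m \<le> (1 - 2 * \<delta>) * r"
    and p: "p \<in> perm_ball A r" "r - m < card (moved p)"
  shows "card (far_close A (r - m) r p) \<le> (4 * \<delta> / (1 + 2 * \<delta>)) ^ m * sphere_vol (card A) r"
proof -
  define k where "k = (r - 2 * m + 2) div 2"
  let ?n = "card A" and ?V = "real (sphere_vol (card A) r)"
  let ?F = "real (card (far_close A (r - m) r p))"
  let ?X = "(4 * \<delta> / (1 + 2 * \<delta>)) ^ m" and ?C = "real (k choose m) * real (card A choose m)"
  have "(1 - 2 * \<delta>) * r \<le> 1 * real r" "\<delta> * ?n \<le> 1 * real ?n"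
    using \<delta> by (intro mult_right_mono; simp)+
  then have m_small: "8 * m \<le> r" and r_le_n: "r \<le> ?n"
    using m r by linarith+
  then have k: "2 * k + r \<le> 2 * (r - m) + 2" "r \<le> 2 * k + 2 * m" "m \<le> k"
    by (auto simp: k_def)
  have "?F * ?C \<le> (real (r choose m))\<^sup>2 * ?V"
    using card_far_close_mult_le[OF A p k(1), of m]
    by (metis (no_types, lifting) of_nat_le_iff of_nat_mult of_nat_power)
  also have "\<dots> \<le> ?X * ?C * ?V"
    using binomial_sq_le_power_mult_binomials[OF \<delta> r m k(2)] by (intro mult_right_mono) auto
  finally have "?F * ?C \<le> ?X * ?V * ?C"
    by (simp only: mult_ac)
  moreover have "0 < ?C"
    using k(3) m_small r_le_n by simp
  ultimately show ?thesis
    by (simp only: mult_le_cancel_right_pos)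
qed

lemma card_close_pairs_le:
  fixes \<delta> :: real
  assumes A: "finite A" and \<delta>: "0 < \<delta>" "\<delta> < 1 / 2" and r: "r \<le> \<delta> * card A"
    and m: "8 * real m \<le> (1 - 2 * \<delta>) * r"
  defines "V \<equiv> real (sphere_vol (card A) r)"
  shows "card (close_pairs A r)
           \<le> V * (2 * card (perm_ball A (r - m)) + (4 * \<delta> / (1 + 2 * \<delta>)) ^ m * V)"
proof -
  let ?B = "perm_ball A r" and ?S = "perm_ball A (r - m)" and ?X = "(4 * \<delta> / (1 + 2 * \<delta>)) ^ m"
  let ?far = "SIGMA p:?B - ?S. far_close A (r - m) r p"
  have fin: "finite ?B" "finite ?S" "finite (far_close A (r - m) r p)" for p
    using finite_perm_ball[OF A] by (auto simp: far_close_def)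
  have V_eq_card: "V = card ?B"
    using card_perm_ball[OF A] by (simp add: V_def)
  have "close_pairs A r \<subseteq> ?S \<times> ?B \<union> ?B \<times> ?S \<union> ?far"
    by (auto simp: close_pairs_def far_close_def perm_ball_def)
  then have "card (close_pairs A r) \<le> card (?S \<times> ?B \<union> ?B \<times> ?S \<union> ?far)"
    using fin by (intro card_mono) auto
  also have "\<dots> \<le> card (?S \<times> ?B) + card (?B \<times> ?S) + card ?far"
    by (intro order_trans[OF card_Un_le] add_right_mono card_Un_le)
  finally have "real (card (close_pairs A r)) \<le> real (2 * card ?B * card ?S + card ?far)"
    by (intro of_nat_mono) (simp add: card_cartesian_product algebra_simps)
  moreover have "real (card ?far) = (\<Sum>p\<in>?B - ?S. real (card (far_close A (r - m) r p)))"
    using fin by (subst card_SigmaI) auto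
  moreover have "\<dots> \<le> card (?B - ?S) * (?X * V)"
    unfolding V_def using card_far_close_le[OF A \<delta> r m]
    by (intro sum_bounded_above) (auto simp: perm_ball_def)
  moreover have "\<dots> \<le> V * (?X * V)"
    unfolding V_eq_card using \<delta> fin by (intro mult_right_mono of_nat_mono card_mono) auto
  ultimately show ?thesis
    by (simp add: V_eq_card algebra_simps)
qed

lemma power_le_exp_mult_ln:
  fixes \<rho> t :: real
  assumes "0 < \<rho>" "\<rho> < 1" "t \<le> m"
  shows "\<rho> ^ m \<le> exp (t * ln \<rho>)"
proof -
  have "\<rho> ^ m = exp (m * ln \<rho>)"
    using assms by (simp add: exp_of_nat_mult)
  also have "\<dots> \<le> exp (t * ln \<rho>)"
    using assms by (simp add: mult_right_mono_neg)
  finally show ?thesis .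
qed

lemma exp_mult_card_close_pairs_le:
  fixes \<beta> \<delta> \<eta> :: real and m r :: nat
  assumes A: "finite A" and \<delta>: "0 < \<delta>" "\<delta> < 1 / 2" and r: "r \<le> \<delta> * card A"
    and m: "8 * real m \<le> (1 - 2 * \<delta>) * r" "\<eta> * card A \<le> m"
    and \<eta>: "0 < \<eta>" "2 * exp (2 / \<eta>) \<le> card A"
    and \<beta>: "2 * \<beta> \<le> 1" "2 * \<beta> \<le> - \<eta> * ln (4 * \<delta> / (1 + 2 * \<delta>))" "2 \<le> \<beta> * card A"
  shows "exp (\<beta> * card A) * card (close_pairs A r) \<le> (real (sphere_vol (card A) r))\<^sup>2"
proof -
  define \<rho> where "\<rho> = 4 * \<delta> / (1 + 2 * \<delta>)"
  let ?n = "real (card A)" and ?V = "real (sphere_vol (card A) r)"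
  let ?S = "perm_ball A (r - m)" and ?e = "exp (- 2 * \<beta> * card A)"
  have \<rho>: "0 < \<rho>" "\<rho> < 1"
    using \<delta> by (auto simp: \<rho>_def field_simps)
  have "(1 - 2 * \<delta>) * r \<le> 1 * real r" "\<delta> * ?n \<le> 1 / 2 * ?n"
    using \<delta> by (intro mult_right_mono; simp)+
  then have m_le_r: "m \<le> r" and r_small: "2 * r \<le> card A"
    using m(1) r by linarith+
  have "card ?S * exp (2 * \<beta> * ?n) \<le> card ?S * exp ?n"
    using mult_right_mono[OF \<beta>(1), of ?n] by (intro mult_left_mono) auto
  also have "\<dots> \<le> ?V"
    using card_perm_ball_mult_exp_le[OF A r_small m_le_r m(2) \<eta>] card_perm_ball[OF A] by simp
  finally have small_ball: "card ?S \<le> ?e * ?V"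
    by (simp add: exp_minus field_simps)
  have "\<rho> ^ m \<le> exp (\<eta> * ?n * ln \<rho>)"
    by (rule power_le_exp_mult_ln[OF \<rho> m(2)])
  also have "\<dots> \<le> ?e"
    using mult_right_mono[OF \<beta>(2), of ?n] by (simp add: \<rho>_def algebra_simps)
  finally have small_ratio: "\<rho> ^ m \<le> ?e" .
  have "card (close_pairs A r) \<le> ?V * (2 * card ?S + \<rho> ^ m * ?V)"
    unfolding \<rho>_def by (rule card_close_pairs_le[OF A \<delta> r m(1)])
  also have "\<dots> \<le> ?V * (2 * (?e * ?V) + ?e * ?V)"
    using small_ball small_ratio by (intro mult_left_mono add_mono mult_right_mono) auto
  also have "\<dots> = 3 * (?e * ?V\<^sup>2)"
    by (simp add: power2_eq_square)
  also have "\<dots> \<le> exp (\<beta> * ?n) * (?e * ?V\<^sup>2)"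
    using \<beta>(3) order_trans[OF _ exp_ge_add_one_self] by (intro mult_right_mono) auto
  finally have "exp (\<beta> * ?n) * card (close_pairs A r)
      \<le> exp (\<beta> * ?n) * (exp (\<beta> * ?n) * (?e * ?V\<^sup>2))"
    by (intro mult_left_mono) auto
  then show ?thesis
    by (simp flip: mult.assoc exp_add)
qed

lemma close_pairs_exponentially_rare:
  fixes \<alpha> \<delta> :: real
  assumes \<alpha>: "0 < \<alpha>" and \<delta>: "0 < \<delta>" "\<delta> < 1 / 2"
  obtains \<beta> :: real and N :: nat where "0 < \<beta>"
    and "\<And>(A :: 'a set) r. finite A \<Longrightarrow> N \<le> card A \<Longrightarrow>
      \<alpha> * card A \<le> r \<Longrightarrow> r \<le> \<delta> * card A \<Longrightarrow>
      exp (\<beta> * card A) * card (close_pairs A r) \<le> (real (sphere_vol (card A) r))\<^sup>2"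
proof -
  define \<epsilon> where "\<epsilon> = (1 - 2 * \<delta>) / 8"
  define \<rho> where "\<rho> = 4 * \<delta> / (1 + 2 * \<delta>)"
  define \<eta> where "\<eta> = \<epsilon> * \<alpha> / 2"
  define \<beta> where "\<beta> = min 1 (- \<eta> * ln \<rho>) / 2"
  define N where "N = nat \<lceil>max (1 / \<eta>) (max (2 * exp (2 / \<eta>)) (2 / \<beta>))\<rceil>"
  have \<epsilon>: "0 < \<epsilon>" and \<rho>: "0 < \<rho>" "\<rho> < 1"
    using \<delta> by (auto simp: \<epsilon>_def \<rho>_def field_simps)
  then have \<eta>: "0 < \<eta>"
    using \<alpha> by (simp add: \<eta>_def)
  then have \<beta>: "0 < \<beta>" "2 * \<beta> \<le> 1" "2 * \<beta> \<le> - \<eta> * ln \<rho>"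
    using \<rho> by (auto simp: \<beta>_def mult_pos_neg)
  have "exp (\<beta> * card A) * card (close_pairs A r) \<le> (real (sphere_vol (card A) r))\<^sup>2"
    if A: "finite A" "N \<le> card A" and r: "\<alpha> * card A \<le> r" "r \<le> \<delta> * card A"
    for A :: "'a set" and r
  proof -
    define m where "m = nat \<lfloor>\<epsilon> * r\<rfloor>"
    have "max (1 / \<eta>) (max (2 * exp (2 / \<eta>)) (2 / \<beta>)) \<le> card A"
      using A(2) unfolding N_def by linarith
    then have n: "1 \<le> \<eta> * card A" "2 * exp (2 / \<eta>) \<le> card A" "2 \<le> \<beta> * card A"
      using \<eta> \<beta> by (auto simp: field_simps)
    have "2 * (\<eta> * card A) \<le> \<epsilon> * r"
      using mult_left_mono[OF r(1), of \<epsilon>] \<epsilon> by (simp add: \<eta>_def mult.assoc)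
    then have "m \<le> \<epsilon> * r" "\<eta> * card A \<le> m"
      using n(1) unfolding m_def by linarith+
    then show ?thesis
      using exp_mult_card_close_pairs_le[OF A(1) \<delta> r(2) _ _ \<eta> n(2) \<beta>(2) _ n(3), of m] \<beta>(3)
      by (simp add: \<epsilon>_def \<rho>_def)
  qed
  then show ?thesis
    by (rule that[OF \<beta>(1)])
qed

section \<open>Permutation codes\<close>

definition code_conflict :: "nat \<Rightarrow> nat \<Rightarrow> (nat \<Rightarrow> nat) \<Rightarrow> (nat \<Rightarrow> nat) \<Rightarrow> bool" where
  "code_conflict n d p q \<longleftrightarrow> p \<noteq> q \<and> hamming_dist n p q < d"

interpretation conflict: simple_graph "code_conflict n d" for n d
proof
  have "hamming_dist n p q = hamming_dist n q p" for p q
    unfolding hamming_dist_def by (rule arg_cong[where f = card]) auto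
  then show "code_conflict n d p q \<Longrightarrow> code_conflict n d q p" for p q
    unfolding code_conflict_def by metis
qed (simp add: code_conflict_def)

lemma perm_code_iff_indep: "perm_code n d C \<longleftrightarrow> C \<subseteq> sym_perms n \<and> conflict.indep n d C"
  by (auto simp: perm_code_def conflict.indep_def code_conflict_def not_less)

lemma card_le_max_code_size: "perm_code n d C \<Longrightarrow> card C \<le> max_code_size n d"
  unfolding max_code_size_def by (intro Max_ge finite_perm_code_sizes) auto

lemma hamming_dist_eq_perm_dist:
  assumes "p permutes {1..n}" "q permutes {1..n}"
  shows "hamming_dist n p q = perm_dist p q"
proof -
  have "{i \<in> {1..n}. p i \<noteq> q i} = {i. p i \<noteq> q i}"
    using permutes_not_in[OF assms(1)] permutes_not_in[OF assms(2)] by force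
  then show ?thesis
    by (simp add: hamming_dist_def perm_dist_def)
qed

lemma inv_comp_mem_perm_ball:
  assumes v: "v permutes {1..n}" and u: "u \<in> conflict.nbhd n d (sym_perms n) v"
  shows "inv v \<circ> u \<in> perm_ball {1..n} (d - 1)"
proof -
  have u: "u permutes {1..n}" "hamming_dist n v u < d"
    using u by (auto simp: conflict.nbhd_def sym_perms_def code_conflict_def)
  have "card (moved (inv v \<circ> u)) = perm_dist (inv v \<circ> v) (inv v \<circ> u)"
    using permutes_inv_o(2)[OF v] by (simp add: moved_def perm_dist_def eq_commute)
  also have "\<dots> = perm_dist v u"
    using v by (intro perm_dist_comp_inj permutes_inj permutes_inv)
  also have "\<dots> = hamming_dist n v u"
    using v u(1) by (rule hamming_dist_eq_perm_dist[symmetric])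
  finally show ?thesis
    using u v by (simp add: perm_ball_def permutes_compose permutes_inv)
qed

lemma inj_inv_comp:
  assumes "v permutes A"
  shows "inj (\<lambda>u. inv v \<circ> u)"
  using assms by (intro fun.inj_map permutes_inj permutes_inv)

lemma card_conflict_nbhd_le:
  assumes v: "v permutes {1..n}"
  shows "card (conflict.nbhd n d (sym_perms n) v) \<le> card (perm_ball {1..n} (d - 1))"
  using inj_inv_comp[OF v] inv_comp_mem_perm_ball[OF v]
  by (intro card_inj_on_le[of "\<lambda>u. inv v \<circ> u"]) (auto intro: inj_on_subset finite_perm_ball)

lemma card_arcs_conflict_nbhd_le:
  assumes v: "v permutes {1..n}"
  shows "card (conflict.arcs n d (conflict.nbhd n d (sym_perms n) v))
           \<le> card (close_pairs {1..n} (d - 1))"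
proof -
  define N where "N = conflict.nbhd n d (sym_perms n) v"
  define f :: "(nat \<Rightarrow> nat) \<Rightarrow> nat \<Rightarrow> nat" where "f = (\<lambda>u. inv v \<circ> u)"
  have dist: "perm_dist (f u) (f w) = perm_dist u w" for u w
    unfolding f_def using v by (intro perm_dist_comp_inj permutes_inj permutes_inv)
  have "map_prod f f ` conflict.arcs n d N \<subseteq> close_pairs {1..n} (d - 1)"
  proof (rule image_subsetI)
    fix a assume "a \<in> conflict.arcs n d N"
    then obtain u w where a: "a = (u, w)" and uw: "u \<in> N" "w \<in> N"
      and "hamming_dist n u w < d"
      by (auto simp: conflict.arcs_def conflict.nbhd_def code_conflict_def)
    moreover have "u permutes {1..n}" "w permutes {1..n}"
      using uw by (auto simp: N_def conflict.nbhd_def sym_perms_def)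
    ultimately have "perm_dist u w < d"
      by (simp add: hamming_dist_eq_perm_dist)
    then show "map_prod f f a \<in> close_pairs {1..n} (d - 1)"
      using inv_comp_mem_perm_ball[OF v, of _ d] uw
      by (simp add: a close_pairs_def dist N_def) (simp add: f_def)
  qed
  moreover have "inj (map_prod f f)"
    unfolding f_def using inj_inv_comp[OF v] by (intro prod.inj_map)
  ultimately show ?thesis
    unfolding N_def by (intro card_inj_on_le[of "map_prod f f"])
      (auto intro: inj_on_subset finite_close_pairs)
qed

lemma max_code_size_ge_of_rare_close_pairs:
  fixes g :: real and n d :: nat
  defines "V \<equiv> real (sphere_vol n (d - 1))"
  assumes g: "exp 2 \<le> g" and rare: "g\<^sup>2 * card (close_pairs {1..n} (d - 1)) \<le> V\<^sup>2"
  shows "exp (- 2) / 4 * ln g * fact n \<le> 2 * V * max_code_size n d"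
proof -
  have V: "V = card (perm_ball {1..n} (d - 1))"
    by (simp add: V_def card_perm_ball)
  have "g\<^sup>2 * 1 \<le> g\<^sup>2 * card (close_pairs {1..n} (d - 1))"
    using id_id_in_close_pairs finite_close_pairs[of "{1..n}"]
    by (intro mult_left_mono) (auto simp: Suc_le_eq card_gt_0_iff)
  also note rare
  finally have "g \<le> V"
    by (intro power2_le_imp_le[of g]) (auto simp: V)
  then obtain I where I: "I \<subseteq> sym_perms n" "conflict.indep n d I"
    "exp (- 2) / 4 * ln g * card (sym_perms n) \<le> 2 * V * card I"
  proof (rule conflict.large_indep_of_locally_sparse[OF finite_sym_perms g, of V n n d])
    fix v assume "v \<in> sym_perms n"
    then have v: "v permutes {1..n}"
      by (simp add: sym_perms_def)
    show "card (conflict.nbhd n d (sym_perms n) v) \<le> V"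
      using card_conflict_nbhd_le[OF v] by (simp add: V)
    have "g\<^sup>2 * card (conflict.arcs n d (conflict.nbhd n d (sym_perms n) v))
        \<le> g\<^sup>2 * card (close_pairs {1..n} (d - 1))"
      using card_arcs_conflict_nbhd_le[OF v] by (intro mult_left_mono of_nat_mono) auto
    then show "g\<^sup>2 * card (conflict.arcs n d (conflict.nbhd n d (sym_perms n) v)) \<le> V\<^sup>2"
      using rare by linarith
  qed
  note I(3)
  also have "2 * V * card I \<le> 2 * V * max_code_size n d"
    using I by (intro mult_left_mono of_nat_mono card_le_max_code_size)
      (auto simp: perm_code_iff_indep V)
  finally show ?thesis
    by (simp add: sym_perms_def card_permutations)
qed

theorem theorem2:
  fixes \<delta> :: real
  assumes "0 < \<delta>" and "\<delta> < 1 / 2"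
  shows "\<exists>c::real. \<exists>N::nat. c > 0 \<and>
    (\<forall>n\<ge>N. \<forall>d::nat. real d = \<delta> * real n \<longrightarrow>
       real (max_code_size n d) \<ge> c * real n * (fact n / real (sphere_vol n (d - 1))))"
proof -
  obtain \<beta> :: real and M :: nat where \<beta>: "0 < \<beta>"
    and rare: "\<And>(A :: nat set) r. finite A \<Longrightarrow> M \<le> card A \<Longrightarrow>
      \<delta> / 2 * card A \<le> r \<Longrightarrow> r \<le> \<delta> * card A \<Longrightarrow>
      exp (\<beta> * card A) * card (close_pairs A r) \<le> (real (sphere_vol (card A) r))\<^sup>2"
    by (rule close_pairs_exponentially_rare[OF half_gt_zero[OF assms(1)] assms])
      (rule that; assumption)
  define N where "N = max M (nat \<lceil>max (2 / \<delta>) (4 / \<beta>)\<rceil>)"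
  have "exp (- 2) * \<beta> / 16 * real n * (fact n / real (sphere_vol n (d - 1))) \<le> max_code_size n d"
    if "N \<le> n" and d: "real d = \<delta> * real n" for n d
  proof -
    have "M \<le> n" "max (2 / \<delta>) (4 / \<beta>) \<le> real n"
      using \<open>N \<le> n\<close> unfolding N_def by linarith+
    then have n: "M \<le> n" "2 \<le> \<delta> * n" "4 \<le> \<beta> * n"
      using assms \<beta> by (auto simp: field_simps)
    then have "\<delta> / 2 * n \<le> real (d - 1)" "real (d - 1) \<le> \<delta> * n"
      using d by auto
    then have "(exp (\<beta> * n / 2))\<^sup>2 * card (close_pairs {1..n} (d - 1))
        \<le> (real (sphere_vol n (d - 1)))\<^sup>2"
      using rare[of "{1..n}" "d - 1"] n(1) by (simp flip: exp_double)
    from max_code_size_ge_of_rare_close_pairs[OF _ this] show ?thesis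
      using n(3) by (cases "sphere_vol n (d - 1) = 0") (auto simp: field_simps)
  qed
  with \<beta> show ?thesis
    by (intro exI[of _ "exp (- 2) * \<beta> / 16"] exI[of _ N]) auto
qed

end
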